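(* Let $k>0$ and $c>0$, and for each integer $L\ge 3$ set $J=J(L)=k\log L$ and $q=q(L)=c\,\frac{\log L}{L}$. Let $\pi_G$ be the Gibbs measure of the two-dimensional Ising model on the torus $\Lambda=(\mathbb Z/L\mathbb Z)^2$ with coupling $J$, and let $\pi_{PCA}$ be the stationary distribution of the probabilistic cellular automaton with parameters $J,q$ on $\Lambda$ (both defined in the context). Then there is a constant $C>0$ (not depending on $L$) such that for all $L$ $$\Vert \pi_{PCA}-\pi_G\Vert_{TV}\le C\left(\frac{1}{L^{\frac c2-1}}+\frac{1}{L^{2k-2}}\right).$$
   Context: Let $\Lambda=(\mathbb Z/L\mathbb Z)^2$ and $\mathcal S=\{-1,1\}^{\Lambda}$. For $x=(i,j)\in\Lambda$ put $x^u=(i,j+1)$, $x^r=(i+1,j)$, $x^d=(i,j-1)$, $x^l=(i-1,j)$ (sums mod $L$), and for $\sigma\in\mathcal S$ write $\sigma_x^u=\sigma_{x^u}$, and similarly $\sigma_x^r,\sigma_x^d,\sigma_x^l$. Ising Gibbs measure: $\pi_G(\sigma)=e^{-H(\sigma)}/Z_G$, with $H(\sigma)=-\sum_{(x,y)}J\sigma_x\sigma_y$, the sum being over unordered pairs of nearest-neighbouring sites of $\Lambda$, and $Z_G=\sum_{\sigma\in\mathcal S}e^{-H(\sigma)}$. PCA: for $\sigma,\tau\in\mathcal S$ let $$H(\sigma,\tau)=-\sum_{x\in\Lambda}\left[J\sigma_x(\tau_x^u+\tau_x^r)+q\sigma_x\tau_x\right]=-\sum_{x\in\Lambda}\left[J\tau_x(\sigma_x^d+\sigma_x^l)+q\sigma_x\tau_x\right],\qquad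 Z_\sigma=\sum_{\tau\in\mathcal S}e^{-H(\sigma,\tau)}.$$ The PCA is the discrete-time Markov chain on $\mathcal S$ with transition matrix $P(\sigma,\tau)=e^{-H(\sigma,\tau)}/Z_\sigma$. Its unique stationary distribution is $\pi_{PCA}(\sigma)=Z_\sigma/\sum_{\sigma'\in\mathcal S}Z_{\sigma'}$. $\Vert\cdot\Vert_{TV}$ denotes total variation distance. *)

theory Defs
  imports "HOL-Analysis.Analysis"
begin

(* The class of a site of (Z/LZ)^2 is represented by its coordinates in {0, ..., L-1}. *)
definition torus :: "nat \<Rightarrow> (int \<times> int) set" where
  "torus L = {0..<int L} \<times> {0..<int L}"

definition site_up :: "nat \<Rightarrow> int \<times> int \<Rightarrow> int \<times> int" where
  "site_up L x = (fst x, (snd x + 1) mod int L)"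

definition site_right :: "nat \<Rightarrow> int \<times> int \<Rightarrow> int \<times> int" where
  "site_right L x = ((fst x + 1) mod int L, snd x)"

definition site_down :: "nat \<Rightarrow> int \<times> int \<Rightarrow> int \<times> int" where
  "site_down L x = (fst x, (snd x - 1) mod int L)"

definition site_left :: "nat \<Rightarrow> int \<times> int \<Rightarrow> int \<times> int" where
  "site_left L x = ((fst x - 1) mod int L, snd x)"

(* Spins are real numbers, so that they can be multiplied by the couplings without coercions. *)
type_synonym config = "int \<times> int \<Rightarrow> real"

definition configs :: "nat \<Rightarrow> config set" where
  "configs L = torus L \<rightarrow>\<^sub>E {-1, 1}"

(* Each unordered pair is one two-element set, hence counted once
   (for L >= 3 the four neighbours of a site are distinct from it and from each other). *)
definition nn_pairs :: "nat \<Rightarrow> (int \<times> int) set set" where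
  "nn_pairs L = {{x, y} | x y. x \<in> torus L \<and>
      y \<in> {site_up L x, site_right L x, site_down L x, site_left L x}}"

definition ising_energy :: "nat \<Rightarrow> real \<Rightarrow> config \<Rightarrow> real" where
  "ising_energy L J \<sigma> = - (\<Sum>e\<in>nn_pairs L. J * (\<Prod>x\<in>e. \<sigma> x))"

definition gibbs :: "nat \<Rightarrow> real \<Rightarrow> config \<Rightarrow> real" where
  "gibbs L J \<sigma> = exp (- ising_energy L J \<sigma>) / (\<Sum>\<sigma>'\<in>configs L. exp (- ising_energy L J \<sigma>'))"

definition pca_energy :: "nat \<Rightarrow> real \<Rightarrow> real \<Rightarrow> config \<Rightarrow> config \<Rightarrow> real" where
  "pca_energy L J q \<sigma> \<tau> =
     - (\<Sum>x\<in>torus L. J * \<sigma> x * (\<tau> (site_up L x) + \<tau> (site_right L x)) + q * \<sigma> x * \<tau> x)"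

definition pca_Z :: "nat \<Rightarrow> real \<Rightarrow> real \<Rightarrow> config \<Rightarrow> real" where
  "pca_Z L J q \<sigma> = (\<Sum>\<tau>\<in>configs L. exp (- pca_energy L J q \<sigma> \<tau>))"

definition pca_trans :: "nat \<Rightarrow> real \<Rightarrow> real \<Rightarrow> config \<Rightarrow> config \<Rightarrow> real" where
  "pca_trans L J q \<sigma> \<tau> = exp (- pca_energy L J q \<sigma> \<tau>) / pca_Z L J q \<sigma>"

definition stationary_distribution ::
  "'a set \<Rightarrow> ('a \<Rightarrow> 'a \<Rightarrow> real) \<Rightarrow> ('a \<Rightarrow> real) \<Rightarrow> bool" where
  "stationary_distribution S P \<mu> \<longleftrightarrow>
     (\<forall>x\<in>S. 0 \<le> \<mu> x) \<and> (\<Sum>x\<in>S. \<mu> x) = 1 \<and> (\<forall>y\<in>S. (\<Sum>x\<in>S. \<mu> x * P x y) = \<mu> y)"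

(* That this is the unique stationary distribution of pca_trans is the lemma
   stationary_pca_iff below. *)
definition pca_stat :: "nat \<Rightarrow> real \<Rightarrow> real \<Rightarrow> config \<Rightarrow> real" where
  "pca_stat L J q \<sigma> = pca_Z L J q \<sigma> / (\<Sum>\<sigma>'\<in>configs L. pca_Z L J q \<sigma>')"

definition tv_dist :: "'a set \<Rightarrow> ('a \<Rightarrow> real) \<Rightarrow> ('a \<Rightarrow> real) \<Rightarrow> real" where
  "tv_dist S \<mu> \<nu> = (\<Sum>x\<in>S. \<bar>\<mu> x - \<nu> x\<bar>) / 2"

lemma finite_torus [simp]: "finite (torus L)"
  by (simp add: torus_def)

lemma finite_configs [simp]: "finite (configs L)"
  unfolding configs_def by (rule finite_PiE) auto

lemma configs_nonempty: "configs L \<noteq> {}"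
  by (auto simp: configs_def PiE_eq_empty_iff)

lemma config_spin: "\<sigma> \<in> configs L \<Longrightarrow> x \<in> torus L \<Longrightarrow> \<sigma> x = -1 \<or> \<sigma> x = 1"
  by (force simp: configs_def)

lemma site_in_torus:
  assumes "x \<in> torus L"
  shows "site_up L x \<in> torus L" "site_right L x \<in> torus L"
        "site_down L x \<in> torus L" "site_left L x \<in> torus L"
  using assms
  by (auto simp: torus_def site_up_def site_right_def site_down_def site_left_def)

lemma site_inverse:
  assumes "x \<in> torus L"
  shows "site_down L (site_up L x) = x" "site_up L (site_down L x) = x"
        "site_left L (site_right L x) = x" "site_right L (site_left L x) = x"
  using assms
  by (auto simp: torus_def site_up_def site_right_def site_down_def site_left_def
      mod_diff_left_eq mod_add_left_eq)

lemma sum_torus_down: "(\<Sum>x\<in>torus L. f (site_down L x)) = (\<Sum>x\<in>torus L. f x)"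
  by (rule sum.reindex_bij_witness[where i = "site_up L" and j = "site_down L"])
     (auto simp: site_in_torus site_inverse)

lemma sum_torus_left: "(\<Sum>x\<in>torus L. f (site_left L x)) = (\<Sum>x\<in>torus L. f x)"
  by (rule sum.reindex_bij_witness[where i = "site_right L" and j = "site_left L"])
     (auto simp: site_in_torus site_inverse)

lemma site_commute:
  "site_down L (site_left L x) = site_left L (site_down L x)"
  by (simp add: site_down_def site_left_def)

lemma pca_energy_alt:
  "pca_energy L J q \<sigma> \<tau> =
     - (\<Sum>x\<in>torus L. J * \<tau> x * (\<sigma> (site_down L x) + \<sigma> (site_left L x)) + q * \<sigma> x * \<tau> x)"
proof -
  have u: "(\<Sum>x\<in>torus L. \<sigma> x * \<tau> (site_up L x)) = (\<Sum>x\<in>torus L. \<tau> x * \<sigma> (site_down L x))"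
    by (subst sum_torus_down[symmetric]) (auto intro!: sum.cong simp: site_inverse)
  have r: "(\<Sum>x\<in>torus L. \<sigma> x * \<tau> (site_right L x)) = (\<Sum>x\<in>torus L. \<tau> x * \<sigma> (site_left L x))"
    by (subst sum_torus_left[symmetric]) (auto intro!: sum.cong simp: site_inverse)
  have "(\<Sum>x\<in>torus L. J * \<sigma> x * (\<tau> (site_up L x) + \<tau> (site_right L x)) + q * \<sigma> x * \<tau> x)
     = J * (\<Sum>x\<in>torus L. \<sigma> x * \<tau> (site_up L x)) + J * (\<Sum>x\<in>torus L. \<sigma> x * \<tau> (site_right L x))
       + (\<Sum>x\<in>torus L. q * \<sigma> x * \<tau> x)"
    by (simp add: sum.distrib sum_distrib_left algebra_simps)
  also have "\<dots> = (\<Sum>x\<in>torus L. J * \<tau> x * (\<sigma> (site_down L x) + \<sigma> (site_left L x)) + q * \<sigma> x * \<tau> x)"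
    unfolding u r by (simp add: sum.distrib sum_distrib_left algebra_simps)
  finally show ?thesis by (simp add: pca_energy_def)
qed

lemma sum_configs_exp:
  "(\<Sum>\<sigma>\<in>configs L. exp (\<Sum>x\<in>torus L. \<sigma> x * h x)) = (\<Prod>x\<in>torus L. 2 * cosh (h x))"
proof -
  have "(\<Sum>\<sigma>\<in>configs L. exp (\<Sum>x\<in>torus L. \<sigma> x * h x))
      = (\<Sum>\<sigma>\<in>torus L \<rightarrow>\<^sub>E {-1, 1}. \<Prod>x\<in>torus L. exp (\<sigma> x * h x))"
    by (simp add: configs_def exp_sum)
  also have "\<dots> = (\<Prod>x\<in>torus L. \<Sum>s\<in>{-1, 1::real}. exp (s * h x))"
    by (rule prod_sum_PiE[symmetric]) auto
  also have "\<dots> = (\<Prod>x\<in>torus L. 2 * cosh (h x))"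
    by (intro prod.cong refl) (simp add: cosh_def field_simps)
  finally show ?thesis .
qed

lemma ln_cosh_three_spins:
  fixes J q :: real
  obtains \<alpha> \<beta> \<gamma> where
    "\<And>a b c. \<lbrakk>a = -1 \<or> a = 1; b = -1 \<or> b = 1; c = -1 \<or> c = 1\<rbrakk> \<Longrightarrow>
       2 * cosh (J * (a + b) + q * c) = exp (\<alpha> + \<beta> * (a * b) + \<gamma> * (a * c) + \<gamma> * (b * c))"
proof -
  define f where "f t = ln (2 * cosh t)" for t :: real
  have ef: "exp (f t) = 2 * cosh t" for t
    by (simp add: f_def)
  have fm: "f (- t) = f t" for t
    by (simp add: f_def)
  define \<alpha> where "\<alpha> = ((f (2*J+q) + f (2*J-q)) / 2 + f q) / 2"
  define \<beta> where "\<beta> = ((f (2*J+q) + f (2*J-q)) / 2 - f q) / 2"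
  define \<gamma> where "\<gamma> = (f (2*J+q) - f (2*J-q)) / 4"
  have "f (J * (a + b) + q * c) = \<alpha> + \<beta> * (a * b) + \<gamma> * (a * c) + \<gamma> * (b * c)"
    if "a = -1 \<or> a = 1" "b = -1 \<or> b = 1" "c = -1 \<or> c = 1" for a b c
    using that fm[of q] fm[of "2*J+q"] fm[of "2*J-q"]
      arg_cong[of "- (2*J+q)" "- (J*2) - q" f]
    by (auto simp: \<alpha>_def \<beta>_def \<gamma>_def field_simps)
  then show thesis
    by (intro that[of \<alpha> \<beta> \<gamma>]) (simp add: ef[symmetric])
qed

lemma pca_Z_reversed:
  assumes \<tau>: "\<tau> \<in> configs L"
  shows "(\<Sum>\<sigma>\<in>configs L. exp (- pca_energy L J q \<sigma> \<tau>)) = pca_Z L J q \<tau>"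
proof -
  obtain \<alpha> \<beta> \<gamma> where ch:
    "\<And>a b c. \<lbrakk>a = -1 \<or> a = 1; b = -1 \<or> b = 1; c = -1 \<or> c = 1\<rbrakk> \<Longrightarrow>
       2 * cosh (J * (a + b) + q * c) = exp (\<alpha> + \<beta> * (a * b) + \<gamma> * (a * c) + \<gamma> * (b * c))"
    using ln_cosh_three_spins[of J q] by blast
  let ?u = "\<lambda>x. \<tau> (site_up L x)" and ?r = "\<lambda>x. \<tau> (site_right L x)"
  let ?d = "\<lambda>x. \<tau> (site_down L x)" and ?l = "\<lambda>x. \<tau> (site_left L x)"
  have ud: "(\<Sum>x\<in>torus L. ?u x * \<tau> x) = (\<Sum>x\<in>torus L. ?d x * \<tau> x)"
    by (subst sum_torus_down[symmetric])
       (auto intro!: sum.cong simp: site_inverse mult.commute)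
  have rl: "(\<Sum>x\<in>torus L. ?r x * \<tau> x) = (\<Sum>x\<in>torus L. ?l x * \<tau> x)"
    by (subst sum_torus_left[symmetric])
       (auto intro!: sum.cong simp: site_inverse mult.commute)
  have "(\<Sum>x\<in>torus L. ?u x * ?r x)
      = (\<Sum>x\<in>torus L. ?u (site_down L x) * ?r (site_down L x))"
    by (rule sum_torus_down[symmetric])
  also have "\<dots> = (\<Sum>x\<in>torus L. ?u (site_down L (site_left L x)) * ?r (site_down L (site_left L x)))"
    by (rule sum_torus_left[symmetric])
  also have "\<dots> = (\<Sum>x\<in>torus L. ?d x * ?l x)"
  proof (rule sum.cong[OF refl])
    fix x assume x: "x \<in> torus L"
    have "site_up L (site_down L (site_left L x)) = site_left L x"
      using x by (simp add: site_inverse site_in_torus)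
    moreover have "site_right L (site_down L (site_left L x)) = site_down L x"
      using x by (simp add: site_commute site_inverse site_in_torus)
    ultimately show "?u (site_down L (site_left L x)) * ?r (site_down L (site_left L x)) = ?d x * ?l x"
      by simp
  qed
  finally have ur: "(\<Sum>x\<in>torus L. ?u x * ?r x) = (\<Sum>x\<in>torus L. ?d x * ?l x)" .
  have "(\<Sum>\<sigma>\<in>configs L. exp (- pca_energy L J q \<sigma> \<tau>))
      = (\<Sum>\<sigma>\<in>configs L. exp (\<Sum>x\<in>torus L. \<sigma> x * (J * (?u x + ?r x) + q * \<tau> x)))"
    by (simp add: pca_energy_def algebra_simps)
  also have "\<dots> = (\<Prod>x\<in>torus L. 2 * cosh (J * (?u x + ?r x) + q * \<tau> x))"
    by (rule sum_configs_exp)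
  also have "\<dots> = (\<Prod>x\<in>torus L. exp (\<alpha> + \<beta> * (?u x * ?r x) + \<gamma> * (?u x * \<tau> x) + \<gamma> * (?r x * \<tau> x)))"
    by (intro prod.cong refl ch config_spin[OF \<tau>] site_in_torus)
  also have "\<dots> = exp ((\<Sum>x\<in>torus L. \<alpha>) + \<beta> * (\<Sum>x\<in>torus L. ?u x * ?r x)
      + \<gamma> * (\<Sum>x\<in>torus L. ?u x * \<tau> x) + \<gamma> * (\<Sum>x\<in>torus L. ?r x * \<tau> x))"
    by (simp only: exp_sum[OF finite_torus, symmetric] sum.distrib sum_distrib_left)
  also have "\<dots> = exp ((\<Sum>x\<in>torus L. \<alpha>) + \<beta> * (\<Sum>x\<in>torus L. ?d x * ?l x)
      + \<gamma> * (\<Sum>x\<in>torus L. ?d x * \<tau> x) + \<gamma> * (\<Sum>x\<in>torus L. ?l x * \<tau> x))"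
    by (simp only: ur ud rl)
  also have "\<dots> = (\<Prod>x\<in>torus L. exp (\<alpha> + \<beta> * (?d x * ?l x) + \<gamma> * (?d x * \<tau> x) + \<gamma> * (?l x * \<tau> x)))"
    by (simp only: exp_sum[OF finite_torus, symmetric] sum.distrib sum_distrib_left)
  also have "\<dots> = (\<Prod>x\<in>torus L. 2 * cosh (J * (?d x + ?l x) + q * \<tau> x))"
    by (intro prod.cong refl ch[symmetric] config_spin[OF \<tau>] site_in_torus)
  also have "\<dots> = (\<Sum>\<sigma>\<in>configs L. exp (\<Sum>x\<in>torus L. \<sigma> x * (J * (?d x + ?l x) + q * \<tau> x)))"
    by (rule sum_configs_exp[symmetric])
  also have "\<dots> = pca_Z L J q \<tau>"
    by (simp add: pca_Z_def pca_energy_alt algebra_simps)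
  finally show ?thesis .
qed

lemma pca_Z_pos: "pca_Z L J q \<sigma> > 0"
  unfolding pca_Z_def by (intro sum_pos) (auto simp: configs_nonempty)

lemma stationary_unique:
  assumes fin: "finite S" and ne: "S \<noteq> {}"
    and P: "\<And>x y. x \<in> S \<Longrightarrow> y \<in> S \<Longrightarrow> P x y > 0"
    and \<pi>: "stationary_distribution S P \<pi>" and pos: "\<And>x. x \<in> S \<Longrightarrow> \<pi> x > 0"
    and \<mu>: "stationary_distribution S P \<mu>"
    and x: "x \<in> S"
  shows "\<mu> x = \<pi> x"
proof -
  define m where "m = Min ((\<lambda>x. \<mu> x / \<pi> x) ` S)"
  have "m \<in> (\<lambda>x. \<mu> x / \<pi> x) ` S"
    unfolding m_def using fin ne by (intro Min_in) auto
  then obtain y where y: "y \<in> S" "m = \<mu> y / \<pi> y" by auto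
  define \<nu> where "\<nu> x = \<mu> x - m * \<pi> x" for x
  have nonneg: "\<nu> x \<ge> 0" if "x \<in> S" for x
  proof -
    have "m \<le> \<mu> x / \<pi> x" unfolding m_def using fin that by (intro Min_le) auto
    then show ?thesis using pos[OF that] by (simp add: \<nu>_def field_simps)
  qed
  have "(\<Sum>x\<in>S. \<nu> x * P x y) = (\<Sum>x\<in>S. \<mu> x * P x y) - m * (\<Sum>x\<in>S. \<pi> x * P x y)"
    by (simp add: \<nu>_def sum_subtractf sum_distrib_left algebra_simps)
  also have "\<dots> = 0"
    using \<pi> \<mu> y pos[OF y(1)] by (simp add: stationary_distribution_def)
  finally have "(\<Sum>x\<in>S. \<nu> x * P x y) = 0" .
  then have "\<forall>x\<in>S. \<nu> x * P x y = 0"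
    using fin nonneg P y(1) by (subst (asm) sum_nonneg_eq_0_iff) (auto simp: less_imp_le)
  then have eq: "\<mu> x = m * \<pi> x" if "x \<in> S" for x
    using P[OF that y(1)] that by (auto simp: \<nu>_def)
  have "1 = (\<Sum>x\<in>S. \<mu> x)" using \<mu> by (simp add: stationary_distribution_def)
  also have "\<dots> = m * (\<Sum>x\<in>S. \<pi> x)" by (simp add: eq sum_distrib_left)
  also have "\<dots> = m" using \<pi> by (simp add: stationary_distribution_def)
  finally show ?thesis using eq[OF x] by simp
qed

lemma stationary_pca_iff:
  "stationary_distribution (configs L) (pca_trans L J q) \<mu> \<longleftrightarrow>
     (\<forall>\<sigma>\<in>configs L. \<mu> \<sigma> = pca_stat L J q \<sigma>)"
proof -
  let ?Z = "\<Sum>\<sigma>'\<in>configs L. pca_Z L J q \<sigma>'"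
  have Z: "?Z > 0"
    by (intro sum_pos) (auto simp: configs_nonempty pca_Z_pos)
  have bal: "(\<Sum>\<sigma>\<in>configs L. pca_stat L J q \<sigma> * pca_trans L J q \<sigma> \<tau>) = pca_stat L J q \<tau>"
    if "\<tau> \<in> configs L" for \<tau>
  proof -
    have "pca_stat L J q \<sigma> * pca_trans L J q \<sigma> \<tau> = exp (- pca_energy L J q \<sigma> \<tau>) / ?Z" for \<sigma>
      using pca_Z_pos[of L J q \<sigma>] by (simp add: pca_stat_def pca_trans_def)
    then have "(\<Sum>\<sigma>\<in>configs L. pca_stat L J q \<sigma> * pca_trans L J q \<sigma> \<tau>)
        = (\<Sum>\<sigma>\<in>configs L. exp (- pca_energy L J q \<sigma> \<tau>)) / ?Z"
      by (simp only: sum_divide_distrib)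
    then show ?thesis
      by (simp only: pca_Z_reversed[OF that] pca_stat_def)
  qed
  have st: "stationary_distribution (configs L) (pca_trans L J q) (pca_stat L J q)"
    unfolding stationary_distribution_def
  proof (intro conjI ballI)
    show "0 \<le> pca_stat L J q \<sigma>" for \<sigma>
      using Z pca_Z_pos[of L J q \<sigma>] by (simp add: pca_stat_def less_imp_le)
    show "(\<Sum>\<sigma>\<in>configs L. pca_stat L J q \<sigma>) = 1"
      using Z by (simp add: pca_stat_def sum_divide_distrib[symmetric])
  qed (rule bal)
  show ?thesis
  proof
    assume \<mu>: "stationary_distribution (configs L) (pca_trans L J q) \<mu>"
    show "\<forall>\<sigma>\<in>configs L. \<mu> \<sigma> = pca_stat L J q \<sigma>"
    proof
      fix \<sigma> assume "\<sigma> \<in> configs L"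
      then show "\<mu> \<sigma> = pca_stat L J q \<sigma>"
      proof (rule stationary_unique[OF finite_configs configs_nonempty _ st _ \<mu>, rotated 2])
        show "pca_trans L J q \<rho> \<tau> > 0" for \<rho> \<tau>
          using pca_Z_pos[of L J q \<rho>] by (simp add: pca_trans_def)
        show "pca_stat L J q \<rho> > 0" for \<rho>
          using Z pca_Z_pos[of L J q \<rho>] by (simp add: pca_stat_def)
      qed
    qed
  next
    assume "\<forall>\<sigma>\<in>configs L. \<mu> \<sigma> = pca_stat L J q \<sigma>"
    with st show "stationary_distribution (configs L) (pca_trans L J q) \<mu>"
      by (simp add: stationary_distribution_def)
  qed
qed

end

(* Summing out tau gives Z_sigma = prod_x 2 cosh (J (sigma_x^d + sigma_x^l) + q sigma_x), a product
   over the antidiagonals i + j = s of the torus: x^d and x^l are adjacent sites of the antidiagonal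
   preceding that of x. Relative to the constant configurations, and up to an overall factor
   (1 + e^(2q - 4J))^(L^2) = O(1), each disagreeing pair of neighbours in an antidiagonal ring costs
   2 e^(-2J) = 2 L^(-2k), and two consecutive constant rings of opposite sign cost
   e^(-2qL) = L^(-2c). Summing over sequences of rings as over paths of a Markov chain (cyclic
   closure is dropped, which only omits factors at most 1), the nonconstant configurations have
   relative weight O(L (L^(-2c) + L^(1-2k))) when k >= 1 and c >= 2; otherwise one of the two terms
   of the bound is at least 1, which suffices. Keeping only the term tau = sigma in Z_sigma shows
   that the relative Gibbs weights are no larger, and both measures give equal mass to the two
   constant configurations. *)

theory Submission
  imports Defs
begin

section \<open>Weighted sums over sequences\<close>

text \<open>A transfer-operator bound: \<open>v\<close> satisfies \<open>g v \<le> l v\<close>, so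
  summing out the last state of a path turns \<open>v (f (Suc n))\<close> into at most
  \<open>l * v (f n)\<close>, and each of the \<open>n\<close> steps costs one factor
  \<open>l\<close>.\<close>

lemma sum_chain_le:
  fixes g :: "'a \<Rightarrow> 'a \<Rightarrow> real" and v w :: "'a \<Rightarrow> real"
  assumes w: "\<And>x. x \<in> S \<Longrightarrow> 0 \<le> w x"
    and g: "\<And>x y. x \<in> S \<Longrightarrow> y \<in> S \<Longrightarrow> 0 \<le> g x y"
    and step: "\<And>x. x \<in> S \<Longrightarrow> (\<Sum>y\<in>S. g x y * v y) \<le> l * v x"
    and l: "0 \<le> l"
  shows "(\<Sum>f\<in>{..<Suc n} \<rightarrow>\<^sub>E S. w (f 0) * (\<Prod>s<n. g (f s) (f (Suc s))) * v (f n))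
           \<le> l ^ n * (\<Sum>x\<in>S. w x * v x)"
proof (induction n)
  case 0
  have "(\<Sum>f\<in>{..<Suc 0} \<rightarrow>\<^sub>E S. w (f 0) * v (f 0)) = (\<Sum>x\<in>S. w x * v x)"
    by (rule sum.reindex_bij_witness[where j = "\<lambda>f. f 0" and i = "\<lambda>x. \<lambda>i\<in>{..<Suc 0}. x"])
       (auto simp: PiE_def extensional_def Pi_def)
  then show ?case by simp
next
  case (Suc n)
  let ?F = "{..<Suc n} \<rightarrow>\<^sub>E S"
  let ?W = "\<lambda>f. w (f 0) * (\<Prod>s<n. g (f s) (f (Suc s)))"
  have W: "0 \<le> ?W f" if "f \<in> ?F" for f
    using that by (intro mult_nonneg_nonneg prod_nonneg w g) (auto simp: PiE_def Pi_def)
  have split: "{..<Suc (Suc n)} = insert (Suc n) {..<Suc n}" by auto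
  let ?G = "\<lambda>f. w (f 0) * (\<Prod>s<Suc n. g (f s) (f (Suc s))) * v (f (Suc n))"
  \<comment> \<open>Here \<open>fst z\<close> is the new last state and \<open>snd z\<close> the
    path without it.\<close>
  have "(\<Sum>f\<in>{..<Suc (Suc n)} \<rightarrow>\<^sub>E S. ?G f)
      = (\<Sum>z\<in>S \<times> ?F. ?G ((snd z)(Suc n := fst z)))"
    unfolding split PiE_insert_eq
    by (subst sum.reindex[OF inj_combinator]) (simp_all only: o_def case_prod_beta lessThan_iff less_irrefl not_False_eq_True)
  also have "\<dots> = (\<Sum>z\<in>S \<times> ?F. ?W (snd z) * (g (snd z n) (fst z) * v (fst z)))"
  proof (rule sum.cong[OF refl])
    fix z :: "'a \<times> (nat \<Rightarrow> 'a)"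
    have "(\<Prod>s<n. g (((snd z)(Suc n := fst z)) s) (((snd z)(Suc n := fst z)) (Suc s)))
        = (\<Prod>s<n. g (snd z s) (snd z (Suc s)))"
      by (intro prod.cong) auto
    then show "?G ((snd z)(Suc n := fst z)) = ?W (snd z) * (g (snd z n) (fst z) * v (fst z))"
      by (simp add: mult_ac)
  qed
  also have "\<dots> = (\<Sum>(y, f)\<in>S \<times> ?F. ?W f * (g (f n) y * v y))"
    by (simp add: case_prod_beta)
  also have "\<dots> = (\<Sum>f\<in>?F. ?W f * (\<Sum>y\<in>S. g (f n) y * v y))"
    by (subst sum.cartesian_product[symmetric], subst sum.swap) (simp add: sum_distrib_left)
  also have "\<dots> \<le> (\<Sum>f\<in>?F. ?W f * (l * v (f n)))"
    by (intro sum_mono mult_left_mono step W) (auto simp: PiE_def Pi_def)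
  also have "\<dots> = l * (\<Sum>f\<in>?F. ?W f * v (f n))"
    by (simp add: sum_distrib_left mult_ac)
  also have "\<dots> \<le> l * (l ^ n * (\<Sum>x\<in>S. w x * v x))"
    using Suc.IH by (intro mult_left_mono l)
  finally show ?case by (simp add: mult_ac)
qed

section \<open>Distance of two measures concentrated on a common pair of atoms\<close>

lemma sum_remove_two:
  assumes "finite S" "p \<in> S" "m \<in> S" "p \<noteq> m"
  shows "sum f S = f p + (f m + sum f (S - {p, m}))"
  using assms by (simp add: sum.remove[of S p] sum.remove[of "S - {p}" m] Diff_insert2[symmetric])

text \<open>If \<open>d\<close> and \<open>d'\<close> are the masses off the atoms, each atom has
  mass (1 - d)/2 or (1 - d')/2. The two atoms contribute |d - d'| to the l1 distance and the rest at
  most d + d', in all 2 max(d, d').\<close>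

lemma tv_dist_two_atoms:
  fixes u w :: "'a \<Rightarrow> real"
  assumes fin: "finite S" and pm: "p \<in> S" "m \<in> S" "p \<noteq> m"
    and u: "\<And>x. x \<in> S \<Longrightarrow> 0 \<le> u x" "u m = u p" "0 < u p"
    and w: "\<And>x. x \<in> S \<Longrightarrow> 0 \<le> w x" "w m = w p" "0 < w p"
    and ru: "(\<Sum>x\<in>S - {p, m}. u x) \<le> e * u p"
    and rw: "(\<Sum>x\<in>S - {p, m}. w x) \<le> e * w p"
  shows "tv_dist S (\<lambda>x. u x / (\<Sum>y\<in>S. u y)) (\<lambda>x. w x / (\<Sum>y\<in>S. w y)) \<le> e"
proof -
  let ?R = "S - {p, m}"
  note split = sum_remove_two[OF fin pm]
  have mass: "\<exists>d. 0 \<le> d \<and> d \<le> e \<and> (\<Sum>x\<in>?R. u x / sum u S) = d \<and> u p / sum u S = (1 - d) / 2"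
    if u: "\<And>x. x \<in> S \<Longrightarrow> 0 \<le> u x" "u m = u p" "0 < u p"
      and ru: "(\<Sum>x\<in>?R. u x) \<le> e * u p" for u :: "'a \<Rightarrow> real"
  proof (intro exI conjI)
    let ?r = "sum u ?R"
    have r: "0 \<le> ?r" using u by (intro sum_nonneg) auto
    have U: "sum u S = 2 * u p + ?r" using split[of u] u by simp
    have e: "0 \<le> e" using r ru u(3) by (smt (verit) mult_neg_pos)
    show "(\<Sum>x\<in>?R. u x / sum u S) = ?r / sum u S" by (simp add: sum_divide_distrib)
    show "0 \<le> ?r / sum u S" using r u(3) by (simp add: U)
    have "e * u p \<le> e * sum u S" using r u(3) e by (intro mult_left_mono) (auto simp: U)
    then show "?r / sum u S \<le> e" using ru r u(3) by (simp add: U field_simps)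
    show "u p / sum u S = (1 - ?r / sum u S) / 2" using r u(3) by (simp add: U field_simps)
  qed
  obtain d where d: "0 \<le> d" "d \<le> e" "(\<Sum>x\<in>?R. u x / sum u S) = d" "u p / sum u S = (1 - d) / 2"
    using mass[OF u ru] by auto
  obtain d' where d': "0 \<le> d'" "d' \<le> e" "(\<Sum>x\<in>?R. w x / sum w S) = d'" "w p / sum w S = (1 - d') / 2"
    using mass[OF w rw] by auto
  have nn: "0 \<le> u x / sum u S" "0 \<le> w x / sum w S" if "x \<in> S" for x
    using that u(1) w(1) by (auto intro!: divide_nonneg_nonneg sum_nonneg)
  have "(\<Sum>x\<in>?R. \<bar>u x / sum u S - w x / sum w S\<bar>) \<le> (\<Sum>x\<in>?R. u x / sum u S + w x / sum w S)"
    using nn by (intro sum_mono) (smt (verit) DiffD1)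
  also have "\<dots> = d + d'" by (simp add: sum.distrib d d')
  finally have "(\<Sum>x\<in>S. \<bar>u x / sum u S - w x / sum w S\<bar>) \<le> 2 * \<bar>(1 - d) / 2 - (1 - d') / 2\<bar> + (d + d')"
    using split[of "\<lambda>x. \<bar>u x / sum u S - w x / sum w S\<bar>"] u(2) w(2) d(4) d'(4) by simp
  also have "\<dots> \<le> 2 * e" using d(1,2) d'(1,2) by (auto simp: abs_if field_simps)
  finally show ?thesis by (simp add: tv_dist_def)
qed

lemma tv_dist_le_1:
  assumes "\<And>x. x \<in> S \<Longrightarrow> 0 \<le> \<mu> x" "\<And>x. x \<in> S \<Longrightarrow> 0 \<le> \<nu> x"
    and "sum \<mu> S = 1" "sum \<nu> S = 1"
  shows "tv_dist S \<mu> \<nu> \<le> 1"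
proof -
  have "(\<Sum>x\<in>S. \<bar>\<mu> x - \<nu> x\<bar>) \<le> (\<Sum>x\<in>S. \<mu> x + \<nu> x)"
    using assms(1,2) by (intro sum_mono) (smt (verit))
  then show ?thesis using assms(3,4) by (simp add: tv_dist_def sum.distrib)
qed

section \<open>Sequences of rings\<close>

text \<open>Domain walls are counted on an open chain: \<open>n + 1\<close> sites have
  \<open>n\<close> pairs, and the closing pair of sites \<open>n\<close> and 0 is left out.\<close>

definition ring_weight :: "real \<Rightarrow> nat \<Rightarrow> (nat \<Rightarrow> real) \<Rightarrow> real" where
  "ring_weight a n \<eta> = (\<Prod>i<n. if \<eta> i = \<eta> (Suc i) then 1 else a)"

definition const_ring :: "nat \<Rightarrow> real \<Rightarrow> nat \<Rightarrow> real" where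
  "const_ring n b = (\<lambda>i\<in>{..<Suc n}. b)"

definition ring_clash :: "nat \<Rightarrow> (nat \<Rightarrow> real) \<Rightarrow> (nat \<Rightarrow> real) \<Rightarrow> bool" where
  "ring_clash n \<eta> \<zeta> \<longleftrightarrow> (\<exists>b\<in>{-1, 1}. \<eta> = const_ring n b \<and> \<zeta> = const_ring n (- b))"

text \<open>The path weight of an unnormalised Markov chain whose states are rings; the step from
  ring \<open>n\<close> back to ring 0 is left out.\<close>

definition rings_weight :: "real \<Rightarrow> real \<Rightarrow> nat \<Rightarrow> (nat \<Rightarrow> nat \<Rightarrow> real) \<Rightarrow> real" where
  "rings_weight a d n f = ring_weight a n (f 0) *
     (\<Prod>s<n. ring_weight a n (f (Suc s)) * (if ring_clash n (f s) (f (Suc s)) then d else 1))"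

abbreviation ring_states :: "nat \<Rightarrow> (nat \<Rightarrow> real) set" where
  "ring_states n \<equiv> {..<Suc n} \<rightarrow>\<^sub>E {-1, 1}"

lemma finite_ring_states [simp]: "finite (ring_states n)"
  by (rule finite_PiE) auto

lemma const_ring_in [simp]: "const_ring n 1 \<in> ring_states n" "const_ring n (-1) \<in> ring_states n"
  by (auto simp: const_ring_def)

lemma const_ring_eq_iff [simp]: "const_ring n b = const_ring n c \<longleftrightarrow> b = c"
  by (metis const_ring_def lessThan_iff restrict_apply' zero_less_Suc)

lemma ring_weight_const [simp]: "ring_weight a n (const_ring n b) = 1"
  unfolding ring_weight_def by (rule prod.neutral) (auto simp: const_ring_def)

lemma ring_weight_nonneg: "0 \<le> a \<Longrightarrow> 0 \<le> ring_weight a n \<eta>"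
  unfolding ring_weight_def by (intro prod_nonneg) auto

text \<open>The 2 by 2 transfer matrix with entries 1 and \<open>a\<close> has row sums
  \<open>1 + a\<close>, so \<open>sum_chain_le\<close> applies with constant
  \<open>v\<close>.\<close>

lemma sum_ring_weight_le:
  assumes "0 \<le> a"
  shows "(\<Sum>\<eta>\<in>ring_states n. ring_weight a n \<eta>) \<le> 2 * (1 + a) ^ n"
proof -
  have "(\<Sum>\<eta>\<in>ring_states n. 1 * (\<Prod>s<n. (\<lambda>x y. if x = y then 1 else a) (\<eta> s) (\<eta> (Suc s))) * 1)
      \<le> (1 + a) ^ n * (\<Sum>x\<in>{-1, 1::real}. 1 * 1)"
    using assms by (intro sum_chain_le) auto
  then show ?thesis by (simp add: ring_weight_def)
qed

text \<open>\<open>r\<close> bounds the total weight of the nonconstant rings: it is the bound for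
  all rings less the weight 1 of each constant one. A second use of \<open>sum_chain_le\<close>,
  with whole rings as states, gives the growth rate \<open>1 + d + 2 * r\<close>.\<close>

lemma sum_rings_weight_le:
  fixes a d :: real and n :: nat
  assumes a: "0 \<le> a" and d: "0 \<le> d"
  defines "r \<equiv> 2 * ((1 + a) ^ n - 1)"
  shows "(\<Sum>f\<in>{..<Suc n} \<rightarrow>\<^sub>E ring_states n. rings_weight a d n f) \<le> 2 * (1 + d + 2 * r) ^ Suc n"
proof -
  let ?S = "ring_states n" and ?p = "const_ring n 1" and ?m = "const_ring n (-1)"
  let ?g = "\<lambda>\<eta> \<zeta>. ring_weight a n \<zeta> * (if ring_clash n \<eta> \<zeta> then d else 1)"
  \<comment> \<open>A nonconstant ring may be followed by constant rings of either sign at no cost; the value 2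
      of v absorbs this.\<close>
  define v :: "(nat \<Rightarrow> real) \<Rightarrow> real" where "v \<eta> = (if \<eta> = ?p \<or> \<eta> = ?m then 1 else 2)" for \<eta>
  let ?l = "1 + d + 2 * r"
  have split: "sum f ?S = f ?p + (f ?m + sum f (?S - {?p, ?m}))" for f :: "_ \<Rightarrow> real"
    by (rule sum_remove_two) simp_all
  have r0: "0 \<le> r" using a by (simp add: r_def)
  have "(\<Sum>\<eta>\<in>?S - {?p, ?m}. ring_weight a n \<eta>) \<le> r"
    using sum_ring_weight_le[OF a, of n] split[of "ring_weight a n"] by (simp add: r_def)
  moreover have "(\<Sum>\<zeta>\<in>?S - {?p, ?m}. ?g \<eta> \<zeta> * v \<zeta>)
      = (\<Sum>\<zeta>\<in>?S - {?p, ?m}. 2 * ring_weight a n \<zeta>)" for \<eta>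
    by (intro sum.cong) (auto simp: v_def ring_clash_def)
  ultimately have rest: "(\<Sum>\<zeta>\<in>?S - {?p, ?m}. ?g \<eta> \<zeta> * v \<zeta>) \<le> 2 * r" for \<eta>
    by (simp add: sum_distrib_left[symmetric])
  \<comment> \<open>From a constant ring, the same ring, its opposite and the nonconstant ones give
    at most 1 + d + 2r. From a nonconstant ring both constant ones come free, giving at most 2 + 2r,
    which is below \<open>2 * ?l\<close>.\<close>
  have step: "(\<Sum>\<zeta>\<in>?S. ?g \<eta> \<zeta> * v \<zeta>) \<le> ?l * v \<eta>" for \<eta>
    using rest[of \<eta>] d r0
    by (subst split) (auto simp: v_def ring_clash_def)
  have "(\<Sum>f\<in>{..<Suc n} \<rightarrow>\<^sub>E ?S. rings_weight a d n f)
      \<le> (\<Sum>f\<in>{..<Suc n} \<rightarrow>\<^sub>E ?S. ring_weight a n (f 0) * (\<Prod>s<n. ?g (f s) (f (Suc s))) * v (f n))"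
  proof (intro sum_mono)
    fix f
    have "0 \<le> rings_weight a d n f"
      unfolding rings_weight_def
      using a d by (intro mult_nonneg_nonneg prod_nonneg ring_weight_nonneg) auto
    moreover have "1 \<le> v (f n)" by (simp add: v_def)
    ultimately have "rings_weight a d n f * 1 \<le> rings_weight a d n f * v (f n)"
      by (intro mult_left_mono)
    then show "rings_weight a d n f
        \<le> ring_weight a n (f 0) * (\<Prod>s<n. ?g (f s) (f (Suc s))) * v (f n)"
      by (simp add: rings_weight_def)
  qed
  also have "\<dots> \<le> ?l ^ n * (\<Sum>\<eta>\<in>?S. ring_weight a n \<eta> * v \<eta>)"
    using a d r0 step by (intro sum_chain_le) (auto intro!: ring_weight_nonneg mult_nonneg_nonneg)
  also have "\<dots> \<le> ?l ^ n * (2 * ?l)"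
  proof (rule mult_left_mono)
    show "0 \<le> ?l ^ n" using d r0 by simp
    have "(\<Sum>\<eta>\<in>?S - {?p, ?m}. ring_weight a n \<eta> * v \<eta>) \<le> 2 * r"
    proof -
      \<comment> \<open>The zero function is no constant ring of spins, so it clashes with nothing;
        \<open>rest\<close> at this argument bounds the sum without clash factors.\<close>
      have "\<not> ring_clash n (\<lambda>_. 0) \<zeta>" for \<zeta>
        by (auto simp: ring_clash_def const_ring_def fun_eq_iff)
      then show ?thesis using rest[of "\<lambda>_. 0"] by simp
    qed
    then show "(\<Sum>\<eta>\<in>?S. ring_weight a n \<eta> * v \<eta>) \<le> 2 * ?l"
      using d r0 by (subst split) (simp add: v_def)
  qed
  finally show ?thesis by (simp only: power_Suc mult_ac)
qed


section \<open>Antidiagonal rings of the torus\<close>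

text \<open>The site with first coordinate \<open>i\<close> on the antidiagonal where the
  coordinates sum to \<open>s\<close> mod \<open>L\<close>. Any natural number \<open>s\<close> is
  allowed, so ring \<open>L\<close> is ring 0 again.\<close>

definition ring_site :: "nat \<Rightarrow> nat \<Rightarrow> nat \<Rightarrow> int \<times> int" where
  "ring_site L s i = (int i, (int s - int i) mod int L)"

definition rings :: "nat \<Rightarrow> config \<Rightarrow> nat \<Rightarrow> nat \<Rightarrow> real" where
  "rings L \<sigma> = (\<lambda>s\<in>{..<L}. \<lambda>i\<in>{..<L}. \<sigma> (ring_site L s i))"

definition const_config :: "nat \<Rightarrow> real \<Rightarrow> config" where
  "const_config L b = (\<lambda>x\<in>torus L. b)"

lemma card_torus: "card (torus L) = L\<^sup>2"
  by (simp add: torus_def power2_eq_square)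

lemma ring_site_in_torus: "i < L \<Longrightarrow> ring_site L s i \<in> torus L"
  by (auto simp: ring_site_def torus_def)

text \<open>The reason for using antidiagonals: the two neighbours entering the factor of a site in
  \<open>pca_Z\<close> are adjacent in the preceding ring. First coordinate 0, where the left
  neighbour wraps around, is treated separately.\<close>

lemma ring_site_neighbours:
  shows "site_down L (ring_site L (Suc s) i) = ring_site L s i"
    and "Suc i < L \<Longrightarrow> site_left L (ring_site L (Suc s) (Suc i)) = ring_site L s i"
  by (auto simp: site_down_def site_left_def ring_site_def mod_diff_left_eq)

lemma torus_ring_site:
  assumes "x \<in> torus L"
  obtains s i where "s < L" "i < L" "x = ring_site L s i"
proof
  show "nat ((fst x + snd x) mod int L) < L" "nat (fst x) < L"
    using assms by (auto simp: torus_def nat_less_iff)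
  show "x = ring_site L (nat ((fst x + snd x) mod int L)) (nat (fst x))"
    using assms by (auto simp: torus_def ring_site_def prod_eq_iff mod_diff_left_eq)
qed

text \<open>The shift to \<open>Suc s\<close> lets \<open>s\<close> index the ring that holds the
  down and left neighbours of the sites multiplied; the last index reaches ring 0 by
  periodicity.\<close>

lemma prod_torus_rings:
  "(\<Prod>x\<in>torus L. h x) = (\<Prod>s<L. \<Prod>i<L. h (ring_site L (Suc s) i))"
proof -
  have "(\<Prod>x\<in>torus L. h x) = (\<Prod>(s, i)\<in>{..<L} \<times> {..<L}. h (ring_site L (Suc s) i))"
  proof (rule prod.reindex_bij_witness[where
        i = "\<lambda>(s, i). ring_site L (Suc s) i" and
        j = "\<lambda>x. (nat ((fst x + snd x - 1) mod int L), nat (fst x))"], goal_cases)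
    case (1 x)
    have "(1 + (fst x + snd x - 1) mod int L - fst x) mod int L
        = (1 + (fst x + snd x - 1) - fst x) mod int L"
      by (metis mod_add_right_eq mod_diff_left_eq)
    then show ?case using 1 by (simp add: torus_def ring_site_def mem_Times_iff prod_eq_iff)
  next
    case (2 x)
    then show ?case by (auto simp: torus_def nat_less_iff)
  next
    case (3 y)
    obtain s i where y: "y = (s, i)" by force
    have "(int i + (1 + int s - int i) mod int L - 1) mod int L
        = (int i + (1 + int s - int i) - 1) mod int L"
      by (metis mod_add_right_eq mod_diff_left_eq)
    then show ?case using 3 by (simp add: ring_site_def y)
  next
    case (4 y)
    then show ?case by (auto intro!: ring_site_in_torus)
  next
    case (5 x)
    have "(1 + (fst x + snd x - 1) mod int L - fst x) mod int L
        = (1 + (fst x + snd x - 1) - fst x) mod int L"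
      by (metis mod_add_right_eq mod_diff_left_eq)
    then have "ring_site L (Suc (nat ((fst x + snd x - 1) mod int L))) (nat (fst x)) = x"
      using 5 by (simp add: torus_def ring_site_def mem_Times_iff prod_eq_iff)
    then show ?case by simp
  qed
  then show ?thesis by (simp add: prod.cartesian_product)
qed

lemma rings_in: "\<sigma> \<in> configs (Suc n) \<Longrightarrow> rings (Suc n) \<sigma> \<in> {..<Suc n} \<rightarrow>\<^sub>E ring_states n"
  using config_spin[OF _ ring_site_in_torus, of \<sigma> "Suc n"] by (auto simp: rings_def)

lemma inj_on_rings: "inj_on (rings L) (configs L)"
proof (rule inj_onI)
  fix \<sigma> \<tau> assume \<sigma>: "\<sigma> \<in> configs L" and \<tau>: "\<tau> \<in> configs L" and eq: "rings L \<sigma> = rings L \<tau>"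
  show "\<sigma> = \<tau>"
  proof (rule PiE_ext[OF \<sigma>[unfolded configs_def] \<tau>[unfolded configs_def]])
    fix x assume "x \<in> torus L"
    then obtain s i where "s < L" "i < L" "x = ring_site L s i" by (rule torus_ring_site)
    then show "\<sigma> x = \<tau> x" using eq by (auto simp: rings_def fun_eq_iff restrict_def split: if_splits)
  qed
qed

lemma const_config_in [simp]: "const_config L 1 \<in> configs L" "const_config L (-1) \<in> configs L"
  by (auto simp: const_config_def configs_def)

lemma const_config_neq: "const_config (Suc n) 1 \<noteq> const_config (Suc n) (-1)"
proof
  assume "const_config (Suc n) 1 = const_config (Suc n) (-1)"
  then have "const_config (Suc n) 1 (0, 0) = const_config (Suc n) (-1) (0, 0)" by simp
  then show False by (simp add: const_config_def torus_def)
qed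

lemma rings_const_config: "s < Suc n \<Longrightarrow> rings (Suc n) (const_config (Suc n) b) s = const_ring n b"
  by (auto simp: rings_def const_config_def const_ring_def ring_site_in_torus)

lemma rings_weight_const_config:
  assumes "b \<noteq> 0"
  shows "rings_weight a d n (rings (Suc n) (const_config (Suc n) b)) = 1"
  using assms by (auto simp: rings_weight_def rings_const_config ring_clash_def intro!: prod.neutral)

section \<open>Bounding the PCA weights\<close>

lemma pca_Z_eq_prod:
  "pca_Z L J q \<sigma> =
     (\<Prod>x\<in>torus L. 2 * cosh (J * (\<sigma> (site_down L x) + \<sigma> (site_left L x)) + q * \<sigma> x))"
  unfolding pca_Z_def pca_energy_alt minus_minus sum_configs_exp[symmetric]
  by (simp add: algebra_simps)

text \<open>The cases are 2 cosh (2J + q), 2 cosh (2J - q) and 2 cosh q. The prefactor is chosen to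
  make the second an equality with penalty exp (-2q).\<close>

lemma two_cosh_three_spins_le:
  fixes a b e J q :: real
  assumes "a = -1 \<or> a = 1" "b = -1 \<or> b = 1" "e = -1 \<or> e = 1" and q: "q \<ge> 0"
  shows "2 * cosh (J * (a + b) + q * e) \<le> exp (2 * J + q) * (1 + exp (2 * q - 4 * J)) *
     (if a \<noteq> b then 2 * exp (- 2 * J) else if a \<noteq> e then exp (- 2 * q) else 1)"
proof -
  have 0: "2 * cosh t = exp t + exp (- t)" for t :: real
    by (simp add: cosh_def)
  have 1: "2 * cosh (2 * J + q) \<le> exp (2 * J + q) * (1 + exp (2 * q - 4 * J))"
    using q by (simp add: 0 distrib_left exp_add[symmetric])
  have 2: "2 * cosh (2 * J - q) = exp (2 * J + q) * (1 + exp (2 * q - 4 * J)) * exp (- 2 * q)"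
    by (simp add: 0 distrib_left distrib_right exp_add[symmetric] algebra_simps)
  have "2 * cosh q \<le> 2 * exp q"
    using q by (simp add: 0)
  also have "\<dots> = exp (2 * J + q) * (2 * exp (- 2 * J))"
    by (simp add: exp_add[symmetric])
  also have "\<dots> \<le> exp (2 * J + q) * (1 + exp (2 * q - 4 * J)) * (2 * exp (- 2 * J))"
    by (intro mult_right_mono) auto
  finally have 3: "2 * cosh q \<le> exp (2 * J + q) * (1 + exp (2 * q - 4 * J)) * (2 * exp (- 2 * J))" .
  have c: "cosh (- (J * 2) - q) = cosh (J * 2 + q)" "cosh (q - J * 2) = cosh (J * 2 - q)"
    using cosh_minus[of "J * 2 + q"] cosh_minus[of "J * 2 - q"] by simp_all
  show ?thesis
    using assms(1-3) 1 2 3 by (auto simp: mult.commute c)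
qed

text \<open>Walls in ring \<open>s\<close> and a clash of ring \<open>s\<close> with ring
  \<open>s + 1\<close> both show in the factors of the sites of ring \<open>s + 1\<close>, whose
  product is \<open>R s\<close>. They never compete, since a clash requires ring \<open>s\<close> to
  have no walls.\<close>

lemma pca_Z_le_rings_weight:
  fixes J q :: real
  assumes \<sigma>: "\<sigma> \<in> configs (Suc n)" and q: "q \<ge> 0" and a1: "2 * exp (- 2 * J) \<le> 1"
  shows "pca_Z (Suc n) J q \<sigma> \<le> (exp (2 * J + q) * (1 + exp (2 * q - 4 * J))) ^ (Suc n)\<^sup>2 *
     rings_weight (2 * exp (- 2 * J)) (exp (- 2 * q) ^ Suc n) n (rings (Suc n) \<sigma>)"
proof -
  let ?L = "Suc n" and ?a = "2 * exp (- 2 * J)"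
  let ?f = "rings ?L \<sigma>" and ?B = "exp (2 * J + q) * (1 + exp (2 * q - 4 * J))"
  define h where "h x = (if \<sigma> (site_down ?L x) \<noteq> \<sigma> (site_left ?L x) then ?a
       else if \<sigma> (site_down ?L x) \<noteq> \<sigma> x then exp (- 2 * q) else 1)" for x
  define R where "R s = (\<Prod>i<?L. h (ring_site ?L (Suc s) i))" for s
  have h0: "0 \<le> h x" and h1: "h x \<le> 1" for x
    using a1 q by (auto simp: h_def)
  have "pca_Z ?L J q \<sigma> \<le> (\<Prod>x\<in>torus ?L. ?B * h x)"
    unfolding pca_Z_eq_prod h_def
    by (intro prod_mono conjI two_cosh_three_spins_le config_spin[OF \<sigma>] site_in_torus q) auto
  also have "\<dots> = ?B ^ ?L\<^sup>2 * (\<Prod>s<?L. R s)"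
    by (simp only: prod.distrib prod_constant card_torus prod_torus_rings R_def power_mult_distrib)
  also have "(\<Prod>s<?L. R s) \<le> rings_weight ?a (exp (- 2 * q) ^ ?L) n ?f"
  proof -
    have weight: "R s \<le> ring_weight ?a n (?f s)" if "s < ?L" for s
    proof -
      \<comment> \<open>The site with first coordinate 0 sees the closing pair of ring
        \<open>s\<close>; its factor is bounded by 1, and the other \<open>n\<close> match the pairs
        of \<open>ring_weight\<close>.\<close>
      have "R s = h (ring_site ?L (Suc s) 0) * (\<Prod>i<n. h (ring_site ?L (Suc s) (Suc i)))"
        unfolding R_def by (rule prod.lessThan_Suc_shift)
      also have "\<dots> \<le> 1 * ring_weight ?a n (?f s)"
        unfolding ring_weight_def
      proof (intro mult_mono prod_mono conjI h0 h1 prod_nonneg)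
        fix i assume "i \<in> {..<n}"
        then show "h (ring_site ?L (Suc s) (Suc i)) \<le> (if ?f s i = ?f s (Suc i) then 1 else ?a)"
          using that h1[of "ring_site ?L (Suc s) (Suc i)"]
          by (auto simp: h_def ring_site_neighbours rings_def)
      qed auto
      finally show ?thesis by simp
    qed
    \<comment> \<open>In a clash every site of ring \<open>s + 1\<close> has both neighbours
      \<open>b\<close> and own spin \<open>- b\<close>, so all \<open>n + 1\<close> factors equal
      exp (-2q), the closing pair included.\<close>
    have clash: "R s = exp (- 2 * q) ^ ?L"
      if s: "s < n" and cl: "ring_clash n (?f s) (?f (Suc s))" for s
    proof -
      obtain b where b: "b \<in> {-1, 1}" "?f s = const_ring n b" "?f (Suc s) = const_ring n (- b)"
        using cl by (auto simp: ring_clash_def)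
      have v: "\<sigma> (ring_site ?L s i) = b" "\<sigma> (ring_site ?L (Suc s) i) = - b" if "i < ?L" for i
        using that s fun_cong[OF b(2), of i] fun_cong[OF b(3), of i]
        by (auto simp: rings_def const_ring_def)
      have "h (ring_site ?L (Suc s) i) = exp (- 2 * q)" if i: "i < ?L" for i
      proof -
        have "\<sigma> (site_left ?L (ring_site ?L (Suc s) i)) = b"
        proof (cases i)
          case 0
          \<comment> \<open>Left of coordinate 0 lies coordinate \<open>n\<close>, and
            \<open>s + 1\<close> and \<open>s - n\<close> agree mod \<open>n + 1\<close>.\<close>
          have "site_left ?L (ring_site ?L (Suc s) 0) = ring_site ?L s n"
            by (simp add: site_left_def ring_site_def zmod_minus1)
               (smt (verit) mod_add_self2 of_nat_Suc)
          then show ?thesis using 0 v(1)[of n] by simp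
        next
          case (Suc j)
          then show ?thesis using i v(1)[of j] by (simp add: ring_site_neighbours)
        qed
        then show ?thesis using b(1) v i by (auto simp: h_def ring_site_neighbours)
      qed
      then show ?thesis by (simp add: R_def)
    qed
    have "R s \<le> ring_weight ?a n (?f s) *
        (if ring_clash n (?f s) (?f (Suc s)) then exp (- 2 * q) ^ ?L else 1)" if "s < n" for s
    proof (cases "ring_clash n (?f s) (?f (Suc s))")
      case True
      then have "ring_weight ?a n (?f s) = 1" by (auto simp: ring_clash_def)
      then show ?thesis using True clash[OF that True] by simp
    next
      case False
      then show ?thesis using weight[of s] that by simp
    qed
    \<comment> \<open>\<open>R n\<close> joins ring \<open>n\<close> to ring 0; only its wall weight
      is kept, so a clash there is not counted.\<close>
    then have "(\<Prod>s<n. R s) * R n \<le> (\<Prod>s<n. ring_weight ?a n (?f s) *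
        (if ring_clash n (?f s) (?f (Suc s)) then exp (- 2 * q) ^ ?L else 1)) * ring_weight ?a n (?f n)"
      by (intro mult_mono prod_mono conjI weight prod_nonneg)
         (auto simp: R_def intro!: prod_nonneg h0 mult_nonneg_nonneg ring_weight_nonneg)
    also have "\<dots> = (\<Prod>s<?L. ring_weight ?a n (?f s)) *
        (\<Prod>s<n. if ring_clash n (?f s) (?f (Suc s)) then exp (- 2 * q) ^ ?L else 1)"
      by (simp add: prod.distrib mult_ac)
    also have "\<dots> = rings_weight ?a (exp (- 2 * q) ^ ?L) n ?f"
      by (simp only: prod.lessThan_Suc_shift rings_weight_def prod.distrib mult.assoc o_def)
    finally show ?thesis by simp
  qed
  finally show ?thesis by (simp add: mult_left_mono)
qed

text \<open>By injectivity of \<open>rings\<close> the sum over configurations is at most the sum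
  over all ring sequences. The \<open>- 1\<close> comes from removing the two constant
  configurations, each of weight 1.\<close>

lemma sum_pca_Z_nonconst_le:
  fixes J q :: real and n :: nat
  assumes q: "q \<ge> 0" and a1: "2 * exp (- 2 * J) \<le> 1"
  defines "r \<equiv> 2 * ((1 + 2 * exp (- 2 * J)) ^ n - 1)"
  shows "(\<Sum>\<sigma>\<in>configs (Suc n) - {const_config (Suc n) 1, const_config (Suc n) (-1)}. pca_Z (Suc n) J q \<sigma>)
     \<le> (exp (2 * J + q) * (1 + exp (2 * q - 4 * J))) ^ (Suc n)\<^sup>2 *
        (2 * ((1 + exp (- 2 * q) ^ Suc n + 2 * r) ^ Suc n - 1))"
proof -
  let ?L = "Suc n" and ?d = "exp (- 2 * q) ^ Suc n" and ?a = "2 * exp (- 2 * J)"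
  let ?p = "const_config ?L 1" and ?m = "const_config ?L (-1)"
  let ?B = "(exp (2 * J + q) * (1 + exp (2 * q - 4 * J))) ^ (Suc n)\<^sup>2"
  let ?w = "\<lambda>\<sigma>. rings_weight ?a ?d n (rings ?L \<sigma>)"
  have "sum ?w (configs ?L) = ?w ?p + (?w ?m + sum ?w (configs ?L - {?p, ?m}))"
    by (rule sum_remove_two) (simp_all add: const_config_neq)
  moreover have "sum ?w (configs ?L) = sum (rings_weight ?a ?d n) (rings ?L ` configs ?L)"
    by (simp add: sum.reindex[OF inj_on_rings])
  moreover have "\<dots> \<le> sum (rings_weight ?a ?d n) ({..<?L} \<rightarrow>\<^sub>E ring_states n)"
    by (intro sum_mono2)
       (auto simp: rings_weight_def intro!: finite_PiE rings_in mult_nonneg_nonneg prod_nonneg ring_weight_nonneg)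
  moreover have "\<dots> \<le> 2 * (1 + ?d + 2 * r) ^ ?L"
    unfolding r_def by (rule sum_rings_weight_le) auto
  ultimately have *: "sum ?w (configs ?L - {?p, ?m}) \<le> 2 * ((1 + ?d + 2 * r) ^ ?L - 1)"
    by (simp add: rings_weight_const_config)
  have "(\<Sum>\<sigma>\<in>configs ?L - {?p, ?m}. pca_Z ?L J q \<sigma>) \<le> (\<Sum>\<sigma>\<in>configs ?L - {?p, ?m}. ?B * ?w \<sigma>)"
    by (intro sum_mono pca_Z_le_rings_weight q a1) auto
  also have "\<dots> = ?B * sum ?w (configs ?L - {?p, ?m})"
    by (simp add: sum_distrib_left)
  also have "\<dots> \<le> ?B * (2 * ((1 + ?d + 2 * r) ^ ?L - 1))"
    by (intro mult_left_mono *) auto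
  finally show ?thesis .
qed

section \<open>Comparison of the two measures\<close>

text \<open>Without fixed points a site and its neighbour form a genuine pair; without 2-cycles the
  pair determines the site it was built from. For L = 2 there are 2-cycles.\<close>

lemma site_up_right_neq:
  assumes "L \<ge> 3" "x \<in> torus L"
  shows "site_up L x \<noteq> x" "site_right L x \<noteq> x"
    and "site_up L (site_up L x) \<noteq> x" "site_right L (site_right L x) \<noteq> x"
proof -
  have m: "(t + 1) mod int L = (if t + 1 = int L then 0 else t + 1)" if "0 \<le> t" "t < int L" for t
    using that by auto
  have "int L \<ge> 3" using assms(1) by simp
  then have "(t + 1) mod int L \<noteq> t" "((t + 1) mod int L + 1) mod int L \<noteq> t"
    if "0 \<le> t" "t < int L" for t
    using that m[of t] m[of "(t + 1) mod int L"] by (auto split: if_splits)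
  then show "site_up L x \<noteq> x" "site_right L x \<noteq> x"
      "site_up L (site_up L x) \<noteq> x" "site_right L (site_right L x) \<noteq> x"
    using assms(2) by (auto simp: torus_def site_up_def site_right_def prod_eq_iff)
qed

text \<open>A down or left pair of \<open>x\<close> is the up or right pair of that
  neighbour.\<close>

lemma nn_pairs_eq:
  "nn_pairs L = (\<lambda>x. {x, site_up L x}) ` torus L \<union> (\<lambda>x. {x, site_right L x}) ` torus L"
proof (intro set_eqI iffI)
  fix e assume "e \<in> nn_pairs L"
  then obtain x y where e: "e = {x, y}" and x: "x \<in> torus L"
    and y: "y \<in> {site_up L x, site_right L x, site_down L x, site_left L x}"
    by (auto simp: nn_pairs_def)
  have "e = {site_down L x, site_up L (site_down L x)}" if "y = site_down L x"
    using x e that by (auto simp: site_inverse)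
  moreover have "e = {site_left L x, site_right L (site_left L x)}" if "y = site_left L x"
    using x e that by (auto simp: site_inverse)
  ultimately show "e \<in> (\<lambda>x. {x, site_up L x}) ` torus L \<union> (\<lambda>x. {x, site_right L x}) ` torus L"
    using x y e site_in_torus(3,4)[OF x] by blast
next
  fix e assume "e \<in> (\<lambda>x. {x, site_up L x}) ` torus L \<union> (\<lambda>x. {x, site_right L x}) ` torus L"
  then show "e \<in> nn_pairs L"
    unfolding nn_pairs_def by blast
qed

text \<open>Brings the Ising energy into the form of \<open>pca_energy\<close> at equal arguments,
  up to the \<open>q\<close> term.\<close>

lemma minus_ising_energy:
  assumes L: "L \<ge> 3"
  shows "- ising_energy L J \<sigma> = (\<Sum>x\<in>torus L. J * \<sigma> x * (\<sigma> (site_up L x) + \<sigma> (site_right L x)))"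
proof -
  let ?U = "\<lambda>x. {x, site_up L x}" and ?R = "\<lambda>x. {x, site_right L x}"
  have iU: "inj_on ?U (torus L)" and iR: "inj_on ?R (torus L)"
    using site_up_right_neq[OF L] by (auto simp: inj_on_def doubleton_eq_iff)
  have disj: "?U ` torus L \<inter> ?R ` torus L = {}"
  proof -
    have False if "x \<in> torus L" "y \<in> torus L" "?U x = ?R y" for x y
    proof -
      \<comment> \<open>The sites of an up pair share their first coordinate; a right pair doing so
        would give a fixed point of \<open>site_right\<close>.\<close>
      have "fst (site_up L x) = fst x" by (simp add: site_up_def)
      then have "fst (site_right L y) = fst y" using that(3) by (auto simp: doubleton_eq_iff)
      then have "site_right L y = y" by (simp add: site_right_def prod_eq_iff)
      then show False using site_up_right_neq(2)[OF L that(2)] by simp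
    qed
    then show ?thesis by auto
  qed
  have "- ising_energy L J \<sigma> = (\<Sum>x\<in>torus L. J * (\<Prod>z\<in>?U x. \<sigma> z)) + (\<Sum>x\<in>torus L. J * (\<Prod>z\<in>?R x. \<sigma> z))"
    unfolding ising_energy_def nn_pairs_eq
    by (simp add: sum.union_disjoint[OF _ _ disj] sum.reindex[OF iU] sum.reindex[OF iR])
  also have "\<dots> = (\<Sum>x\<in>torus L. J * (\<sigma> x * \<sigma> (site_up L x))) + (\<Sum>x\<in>torus L. J * (\<sigma> x * \<sigma> (site_right L x)))"
    using site_up_right_neq(1,2)[OF L, symmetric] by (intro arg_cong2[of _ _ _ _ "(+)"] sum.cong) auto
  finally show ?thesis by (simp add: sum.distrib[symmetric] algebra_simps)
qed

lemma exp_ising_le_pca_Z: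
  assumes "L \<ge> 3" and \<sigma>: "\<sigma> \<in> configs L"
  shows "exp (- ising_energy L J \<sigma>) * exp q ^ L\<^sup>2 \<le> pca_Z L J q \<sigma>"
proof -
  have "- pca_energy L J q \<sigma> \<sigma> = - ising_energy L J \<sigma> + (\<Sum>x\<in>torus L. q * \<sigma> x * \<sigma> x)"
    by (simp add: pca_energy_def minus_ising_energy[OF assms(1)] sum.distrib)
  also have "(\<Sum>x\<in>torus L. q * \<sigma> x * \<sigma> x) = (\<Sum>x\<in>torus L. q)"
    using config_spin[OF \<sigma>] by (intro sum.cong) fastforce+
  finally have "exp (- pca_energy L J q \<sigma> \<sigma>) = exp (- ising_energy L J \<sigma>) * exp q ^ L\<^sup>2"
    by (simp only: exp_add sum_constant card_torus exp_of_nat_mult)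
  moreover have "exp (- pca_energy L J q \<sigma> \<sigma>) \<le> pca_Z L J q \<sigma>"
    unfolding pca_Z_def by (rule member_le_sum) (use \<sigma> in auto)
  ultimately show ?thesis by simp
qed

lemma exp_ising_const_config:
  assumes "L \<ge> 3" "b = -1 \<or> b = 1"
  shows "exp (- ising_energy L J (const_config L b)) = exp (2 * J) ^ L\<^sup>2"
proof -
  have "- ising_energy L J (const_config L b) = (\<Sum>x\<in>torus L. 2 * J)"
    unfolding minus_ising_energy[OF assms(1)] using assms(2)
    by (intro sum.cong) (auto simp: const_config_def site_in_torus)
  then show ?thesis by (simp add: card_torus exp_of_nat_mult[symmetric])
qed

lemma pca_Z_const_config:
  assumes "b = -1 \<or> b = 1"
  shows "pca_Z L J q (const_config L b) = (2 * cosh (2 * J + q)) ^ L\<^sup>2"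
proof -
  have "cosh (- (J * 2) - q) = cosh (J * 2 + q)"
    using cosh_minus[of "J * 2 + q"] by simp
  then have "pca_Z L J q (const_config L b) = (\<Prod>x\<in>torus L. 2 * cosh (2 * J + q))"
    unfolding pca_Z_eq_prod using assms
    by (intro prod.cong) (auto simp: const_config_def site_in_torus mult.commute)
  then show ?thesis by (simp add: card_torus)
qed

text \<open>One error serves both measures. The PCA weight off the atoms is at most exp ((2J + q)
  L^2) times \<open>?e\<close>. That exponential is at most the PCA weight of a constant
  configuration, and equals its Gibbs weight times exp (q L^2), the factor in
  \<open>exp_ising_le_pca_Z\<close>, which cancels.\<close>

lemma tv_dist_pca_gibbs_le:
  fixes J q :: real
  assumes n: "n \<ge> 2" and q: "q \<ge> 0" and a1: "2 * exp (- 2 * J) \<le> 1"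
  defines "r \<equiv> 2 * ((1 + 2 * exp (- 2 * J)) ^ n - 1)"
  shows "tv_dist (configs (Suc n)) (pca_stat (Suc n) J q) (gibbs (Suc n) J)
     \<le> (1 + exp (2 * q - 4 * J)) ^ (Suc n)\<^sup>2 * (2 * ((1 + exp (- 2 * q) ^ Suc n + 2 * r) ^ Suc n - 1))"
    (is "_ \<le> ?e")
proof -
  let ?L = "Suc n" and ?S = "configs (Suc n)"
  let ?p = "const_config ?L 1" and ?m = "const_config ?L (-1)"
  let ?G = "\<lambda>\<sigma>. exp (- ising_energy ?L J \<sigma>)"
  have L: "?L \<ge> 3" using n by simp
  have "1 \<le> (1 + 2 * exp (- 2 * J)) ^ n" by (rule one_le_power) simp
  then have "1 \<le> (1 + exp (- 2 * q) ^ ?L + 2 * r) ^ ?L"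
    by (intro one_le_power add_increasing2 mult_nonneg_nonneg) (simp_all add: r_def)
  then have e0: "0 \<le> ?e" by (intro mult_nonneg_nonneg) auto
  have rest: "(\<Sum>\<sigma>\<in>?S - {?p, ?m}. pca_Z ?L J q \<sigma>) \<le> exp (2 * J + q) ^ ?L\<^sup>2 * ?e"
    using sum_pca_Z_nonconst_le[OF q a1, of n]
    by (simp only: power_mult_distrib mult.assoc r_def)
  also have "\<dots> \<le> (2 * cosh (2 * J + q)) ^ ?L\<^sup>2 * ?e"
    by (intro mult_right_mono power_mono e0) (auto simp: cosh_def)
  finally have rest_pca: "(\<Sum>\<sigma>\<in>?S - {?p, ?m}. pca_Z ?L J q \<sigma>) \<le> ?e * pca_Z ?L J q ?p"
    by (simp only: pca_Z_const_config mult.commute simp_thms)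
  have "(\<Sum>\<sigma>\<in>?S - {?p, ?m}. ?G \<sigma>) * exp q ^ ?L\<^sup>2 = (\<Sum>\<sigma>\<in>?S - {?p, ?m}. ?G \<sigma> * exp q ^ ?L\<^sup>2)"
    by (rule sum_distrib_right)
  also have "\<dots> \<le> (\<Sum>\<sigma>\<in>?S - {?p, ?m}. pca_Z ?L J q \<sigma>)"
    by (intro sum_mono exp_ising_le_pca_Z L) auto
  also note rest
  also have "exp (2 * J + q) ^ ?L\<^sup>2 * ?e = ?e * ?G ?p * exp q ^ ?L\<^sup>2"
    by (simp only: exp_ising_const_config[OF L] exp_add power_mult_distrib mult_ac simp_thms)
  finally have rest_gibbs: "(\<Sum>\<sigma>\<in>?S - {?p, ?m}. ?G \<sigma>) \<le> ?e * ?G ?p"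
    by (rule mult_right_le_imp_le) simp
  have "tv_dist ?S (\<lambda>\<sigma>. pca_Z ?L J q \<sigma> / (\<Sum>\<tau>\<in>?S. pca_Z ?L J q \<tau>)) (\<lambda>\<sigma>. ?G \<sigma> / (\<Sum>\<tau>\<in>?S. ?G \<tau>)) \<le> ?e"
    by (rule tv_dist_two_atoms[OF finite_configs const_config_in const_config_neq
          _ _ _ _ _ _ rest_pca rest_gibbs])
       (auto simp: pca_Z_pos less_imp_le pca_Z_const_config exp_ising_const_config[OF L])
  then show ?thesis
    by (simp only: pca_stat_def[abs_def] gibbs_def[abs_def])
qed

lemma tv_dist_pca_gibbs_le_1: "tv_dist (configs L) (pca_stat L J q) (gibbs L J) \<le> 1"
proof -
  have "0 < (\<Sum>\<sigma>\<in>configs L. pca_Z L J q \<sigma>)" "0 < (\<Sum>\<sigma>\<in>configs L. exp (- ising_energy L J \<sigma>))"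
    by (auto intro!: sum_pos simp: configs_nonempty pca_Z_pos)
  then show ?thesis
    by (intro tv_dist_le_1)
       (auto simp: pca_stat_def gibbs_def sum_divide_distrib[symmetric] less_imp_le pca_Z_pos)
qed

section \<open>Size of the error under the scaling of J and q\<close>

lemma exp_minus_one_le: "exp t - 1 \<le> t * exp t" for t :: real
proof -
  have "(1 - t) * exp t \<le> exp (- t) * exp t"
    using exp_ge_add_one_self[of "- t"] by (intro mult_right_mono) auto
  then show ?thesis by (simp add: exp_minus algebra_simps)
qed

lemma one_plus_power_le_exp: "(1 + x) ^ n \<le> exp (real n * x)" if "0 \<le> x" for x :: real
proof -
  have "(1 + x) ^ n \<le> exp x ^ n"
    using that by (intro power_mono exp_ge_add_one_self) auto
  then show ?thesis by (simp add: exp_of_nat_mult)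
qed

text \<open>With x = d + 2r, the quantity (1 + x)^L - 1 is at most \<open>y * exp y\<close> for an
  upper bound \<open>y\<close> of L x. This \<open>y\<close> is at most a constant times the claimed
  rate, and it is bounded because \<open>k \<ge> 1\<close> and \<open>c \<ge> 2\<close>, so
  \<open>exp y\<close> goes into the constant.\<close>

lemma tv_dist_pca_gibbs_scaling:
  fixes k c :: real
  assumes k: "k \<ge> 1" and c: "c \<ge> 2" and L: "L \<ge> 3"
  defines "J \<equiv> k * ln (real L)" and "q \<equiv> c * ln (real L) / real L"
  shows "tv_dist (configs L) (pca_stat L J q) (gibbs L J)
     \<le> exp (exp (2 * c)) * (2 * exp (1 + 8 * exp 2)) * (8 * exp 2) *
        (real L powr (1 - c / 2) + real L powr (2 - 2 * k))"
proof -
  let ?l = "real L"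
  obtain n where n: "L = Suc n" using L by (cases L) auto
  have l: "?l \<ge> 3" using L by simp
  have q: "q \<ge> 0" using c l by (auto simp: q_def)
  have pw: "exp (t * ln ?l) = ?l powr t" for t
    using l by (simp add: powr_def)
  have a: "exp (- 2 * J) = ?l powr (- 2 * k)"
    unfolding pw[symmetric] by (simp add: J_def)
  have d: "exp (- 2 * q) ^ L = ?l powr (- 2 * c)"
    unfolding pw[symmetric] using l by (simp add: q_def exp_of_nat_mult[symmetric])
  have "?l powr (- 2 * k) \<le> ?l powr (- 1)"
    using k l by (intro powr_mono) auto
  also have "\<dots> \<le> 1 / 3" using l by (simp add: powr_minus_divide)
  finally have a1: "2 * exp (- 2 * J) \<le> 1" unfolding a by linarith
  \<comment> \<open>After 1 + x \<le> exp x the exponent is L^2 exp (-4J) exp (2q), where L^2 exp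
    (-4J) \<le> 1 by \<open>k \<ge> 1\<close>, and q \<le> c by ln L \<le> L.\<close>
  have grow: "(1 + exp (2 * q - 4 * J)) ^ L\<^sup>2 \<le> exp (exp (2 * c))"
  proof -
    have "ln ?l \<le> ?l" using l ln_le_minus_one[of ?l] by simp
    then have "c * ln ?l \<le> c * ?l" using c by (intro mult_left_mono) auto
    then have "q \<le> c" using l by (simp add: q_def field_simps)
    have "exp (- 4 * J) = ?l powr (- 4 * k)" unfolding pw[symmetric] by (simp add: J_def)
    also have "\<dots> \<le> ?l powr (- 2)" using k l by (intro powr_mono) auto
    finally have "real (L\<^sup>2) * exp (- 4 * J) \<le> ?l\<^sup>2 * ?l powr (- 2)"
      by (simp add: mult_left_mono)
    also have "\<dots> = 1" using l by (simp add: powr_minus powr_numeral)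
    finally have "real (L\<^sup>2) * exp (- 4 * J) * exp (2 * q) \<le> 1 * exp (2 * c)"
      using \<open>q \<le> c\<close> by (intro mult_mono) auto
    moreover have "exp (2 * q - 4 * J) = exp (- 4 * J) * exp (2 * q)"
      by (simp add: exp_add[symmetric])
    ultimately have "real (L\<^sup>2) * exp (2 * q - 4 * J) \<le> exp (2 * c)"
      by (simp only: mult.assoc mult_1)
    then show ?thesis
      using one_plus_power_le_exp[of "exp (2 * q - 4 * J)" "L\<^sup>2"] by (smt (verit) exp_ge_zero exp_le_cancel_iff)
  qed
  define r where "r = 2 * ((1 + 2 * exp (- 2 * J)) ^ n - 1)"
  \<comment> \<open>\<open>t\<close> is L times the wall cost, so (1 + a)^n \<le> exp t for a ring;
    \<open>t \<le> 2\<close> then makes \<open>r\<close> linear in \<open>t\<close>.\<close>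
  define t where "t = 2 * ?l powr (1 - 2 * k)"
  \<comment> \<open>The first term is L times the clash cost; the second bounds L * 2r, with 8 = 2 *
    2 * 2 from 2r, r \<le> 2 t exp 2 and the 2 in \<open>t\<close>.\<close>
  define y where "y = ?l powr (1 - 2 * c) + 8 * exp 2 * ?l powr (2 - 2 * k)"
  have t: "t = ?l * (2 * exp (- 2 * J))"
    unfolding t_def a using l powr_add[of ?l 1 "- 2 * k"] by simp
  have le1: "?l powr s \<le> 1" if "s \<le> 0" for s
    using powr_mono[OF that, of ?l] l by simp
  have t2: "0 \<le> t" "t \<le> 2" using le1[of "1 - 2 * k"] k by (auto simp: t_def)
  have "(1 + 2 * exp (- 2 * J)) ^ n \<le> exp (real n * (2 * exp (- 2 * J)))"
    by (rule one_plus_power_le_exp) simp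
  also have "\<dots> \<le> exp t"
    unfolding t exp_le_cancel_iff by (intro mult_right_mono) (auto simp: n)
  finally have "(1 + 2 * exp (- 2 * J)) ^ n - 1 \<le> t * exp t"
    using exp_minus_one_le[of t] by linarith
  also have "\<dots> \<le> t * exp 2" using t2 by (intro mult_left_mono) auto
  finally have r: "r \<le> 2 * (t * exp 2)" by (simp add: r_def)
  have r0: "0 \<le> r" by (simp add: r_def)
  have y: "?l * (?l powr (- 2 * c) + 2 * r) \<le> y"
  proof -
    have "?l * (2 * r) \<le> ?l * (2 * (2 * (t * exp 2)))"
      using r by (intro mult_left_mono) auto
    also have "\<dots> = 8 * exp 2 * ?l powr (2 - 2 * k)"
      using l powr_add[of ?l 1 "1 - 2 * k"] by (simp add: t_def)
    finally have "?l * (2 * r) \<le> 8 * exp 2 * ?l powr (2 - 2 * k)" .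
    moreover have "?l * ?l powr (- 2 * c) = ?l powr (1 - 2 * c)"
      using l powr_add[of ?l 1 "- 2 * c"] by simp
    ultimately show ?thesis by (simp add: y_def distrib_left)
  qed
  have y1: "y \<le> 1 + 8 * exp 2"
    using le1[of "1 - 2 * c"] le1[of "2 - 2 * k"] k c by (auto simp: y_def intro!: add_mono)
  have y0: "0 \<le> y" by (simp add: y_def)
  have "(1 + exp (- 2 * q) ^ L + 2 * r) ^ L \<le> exp (?l * (?l powr (- 2 * c) + 2 * r))"
    using one_plus_power_le_exp[of "?l powr (- 2 * c) + 2 * r" L] r0
    unfolding d by (simp add: add.assoc)
  also have "\<dots> \<le> exp y" using y by simp
  finally have "(1 + exp (- 2 * q) ^ L + 2 * r) ^ L - 1 \<le> y * exp y"
    using exp_minus_one_le[of y] by linarith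
  also have "\<dots> \<le> y * exp (1 + 8 * exp 2)" using y0 y1 by (intro mult_left_mono) auto
  also have "\<dots> \<le> (8 * exp 2 * (?l powr (1 - c / 2) + ?l powr (2 - 2 * k))) * exp (1 + 8 * exp 2)"
  proof (rule mult_right_mono)
    \<comment> \<open>The clash term decays faster than the claimed rate and is weakened
      here.\<close>
    have "?l powr (1 - 2 * c) \<le> ?l powr (1 - c / 2)"
      using c l by (intro powr_mono) auto
    also have "\<dots> \<le> 8 * exp 2 * ?l powr (1 - c / 2)"
      using mult_right_mono[of 1 "8 * exp 2" "?l powr (1 - c / 2)"] exp_ge_add_one_self[of 2] by simp
    finally show "y \<le> 8 * exp 2 * (?l powr (1 - c / 2) + ?l powr (2 - 2 * k))"
      by (simp add: y_def distrib_left)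
  qed simp
  finally have "(1 + exp (2 * q - 4 * J)) ^ L\<^sup>2 * (2 * ((1 + exp (- 2 * q) ^ L + 2 * r) ^ L - 1))
      \<le> exp (exp (2 * c)) * (2 * ((8 * exp 2 * (?l powr (1 - c / 2) + ?l powr (2 - 2 * k))) * exp (1 + 8 * exp 2)))"
    using r0 by (intro mult_mono grow) (auto intro!: one_le_power)
  moreover have "tv_dist (configs L) (pca_stat L J q) (gibbs L J)
      \<le> (1 + exp (2 * q - 4 * J)) ^ L\<^sup>2 * (2 * ((1 + exp (- 2 * q) ^ L + 2 * r) ^ L - 1))"
    using tv_dist_pca_gibbs_le[OF _ q a1, of n] L unfolding n r_def by simp
  ultimately show ?thesis by (simp only: mult_ac)
qed

theorem theorem2p3:
  fixes k c :: real
  assumes "k > 0" and "c > 0"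
  shows "\<exists>C>0. \<forall>L::nat. L \<ge> 3 \<longrightarrow>
           (let J = k * ln (real L); q = c * ln (real L) / real L in
            tv_dist (configs L) (pca_stat L J q) (gibbs L J)
              \<le> C * (1 / real L powr (c / 2 - 1) + 1 / real L powr (2 * k - 2)))"
proof -
  define C where "C = exp (exp (2 * c)) * (2 * exp (1 + 8 * exp 2)) * (8 * exp 2)"
  have "tv_dist (configs L) (pca_stat L (k * ln (real L)) (c * ln (real L) / real L)) (gibbs L (k * ln (real L)))
      \<le> max 1 C * (1 / real L powr (c / 2 - 1) + 1 / real L powr (2 * k - 2))" (is "?tv \<le> _ * ?b")
    if L: "L \<ge> 3" for L :: nat
  proof -
    have b: "?b = real L powr (1 - c / 2) + real L powr (2 - 2 * k)"
      by (simp add: powr_minus_divide[symmetric])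
    show ?thesis
    proof (cases "k \<ge> 1 \<and> c \<ge> 2")
      case True
      then have "?tv \<le> C * ?b"
        unfolding b C_def by (intro tv_dist_pca_gibbs_scaling) (use L in auto)
      also have "\<dots> \<le> max 1 C * ?b"
        by (intro mult_right_mono) auto
      finally show ?thesis .
    next
      case False
      \<comment> \<open>One of the exponents 1 - c/2 and 2 - 2k is positive here, so
        \<open>?b\<close> is at least 1, and \<open>max 1 C\<close> keeps the bound above the
        trivial 1.\<close>
      have "1 \<le> real L powr s" if "s \<ge> 0" for s
        using that L by (intro ge_one_powr_ge_zero) auto
      then have "1 \<le> ?b"
        unfolding b using False by (smt (verit) field_sum_of_halves powr_ge_zero)
      then have "1 * 1 \<le> max 1 C * ?b" by (intro mult_mono) auto
      then show ?thesis
        using tv_dist_pca_gibbs_le_1[of L "k * ln (real L)" "c * ln (real L) / real L"] by linarith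
    qed
  qed
  then show ?thesis
    by (intro exI[of _ "max 1 C"]) (simp add: Let_def)
qed

end
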